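(* Let $r\ge2$ be an integer and let $\delta$ be a positive constant. If $p=p(n)$ satisfies $1/n\ll p\le1-\delta$, then \[ \mathbb{E}[x_r(G_{n,p})]=\Omega\left(\sqrt{n/p}\right). \]
   Context: An $r$-cut in a graph $G$ is a partition of its vertex set into $r$ subsets (parts may be empty); its size is the number of edges of $G$ with endpoints in different parts, and a maximum $r$-cut is one of the largest size. Two vertices of $G$ are $(0,r)$-equivalent if they are in the same part of every maximum $r$-cut of $G$; the equivalence classes are the $(0,r)$-components of $G$. When the $r$ largest $(0,r)$-components $C_1,\dotsc,C_r$ have strictly more than $|V(G)|/(r+1)$ vertices each, the set $\{C_1,\dotsc,C_r\}$ is called the $(0,r)$-core of $G$; otherwise $G$ has no $(0,r)$-core. Let $X_r(G)$ denote the set of vertices of $G$ not belonging to (any of the components of) the $(0,r)$-core of $G$, with $X_r(G)=V(G)$ if $G$ does not have a $(0,r)$-core, and let $x_r(G)=|X_r(G)|$. $G_{n,p}$ is the binomial random graph on $n$ vertices with edge probability $p$; $f\ll g$ means $f/g\to0$ as $n\to\infty$; $f=\Omega(g)$ means that there is a constant $c>0$ with $f\ge cg$ for all sufficiently large $n$. *)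

theory Defs
  imports "HOL-Probability.Probability" "HOL-Library.Landau_Symbols"
begin

text \<open>
  A finite simple graph is given by a vertex set \<open>V\<close> and a set \<open>E\<close> of two-element subsets of \<open>V\<close>.
\<close>

definition all_edges :: "'a set \<Rightarrow> 'a set set" where
  "all_edges V = {e. e \<subseteq> V \<and> card e = 2}"

text \<open>
  A partition of \<open>V\<close> into \<open>r\<close> possibly empty parts is given by the function sending each vertex to
  the index of its part. Relabelling the parts changes neither the size of a cut nor which vertices
  lie in a common part.
\<close>

definition cuts :: "nat \<Rightarrow> 'a set \<Rightarrow> ('a \<Rightarrow> nat) set" where
  "cuts r V = V \<rightarrow>\<^sub>E {..<r}"

definition cut_size :: "'a set set \<Rightarrow> ('a \<Rightarrow> nat) \<Rightarrow> nat" where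
  "cut_size E f = card {e \<in> E. \<exists>u\<in>e. \<exists>v\<in>e. f u \<noteq> f v}"

definition max_cuts :: "nat \<Rightarrow> 'a set \<Rightarrow> 'a set set \<Rightarrow> ('a \<Rightarrow> nat) set" where
  "max_cuts r V E = {f \<in> cuts r V. \<forall>g\<in>cuts r V. cut_size E g \<le> cut_size E f}"

definition cut_equiv :: "nat \<Rightarrow> 'a set \<Rightarrow> 'a set set \<Rightarrow> ('a \<times> 'a) set" where
  "cut_equiv r V E = {(u, v) \<in> V \<times> V. \<forall>f\<in>max_cuts r V E. f u = f v}"

definition cut_components :: "nat \<Rightarrow> 'a set \<Rightarrow> 'a set set \<Rightarrow> 'a set set" where
  "cut_components r V E = V // cut_equiv r V E"

text \<open>
  \<open>K\<close> consists of \<open>r\<close> largest components, each of which has more than \<open>|V| / (r + 1)\<close> vertices.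
  Such a \<open>K\<close> is unique: see \<open>is_core_unique\<close> below.
\<close>

definition is_core :: "nat \<Rightarrow> 'a set \<Rightarrow> 'a set set \<Rightarrow> 'a set set \<Rightarrow> bool" where
  "is_core r V E K \<longleftrightarrow>
     K \<subseteq> cut_components r V E \<and> finite K \<and> card K = r \<and>
     (\<forall>C\<in>K. \<forall>D\<in>cut_components r V E - K. card D \<le> card C) \<and>
     (\<forall>C\<in>K. real (card C) > real (card V) / (real r + 1))"

definition core_exterior :: "nat \<Rightarrow> 'a set \<Rightarrow> 'a set set \<Rightarrow> 'a set" where
  "core_exterior r V E =
     (if \<exists>K. is_core r V E K then V - \<Union>(THE K. is_core r V E K) else V)"

definition x_core :: "nat \<Rightarrow> 'a set \<Rightarrow> 'a set set \<Rightarrow> nat" where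
  "x_core r V E = card (core_exterior r V E)"

text \<open>
  The edge set of the binomial random graph with vertex set \<open>{..<n}\<close>: every possible edge is
  included independently with probability \<open>p\<close>.
\<close>

definition binomial_graph :: "nat \<Rightarrow> real \<Rightarrow> nat set set pmf" where
  "binomial_graph n p =
     map_pmf (\<lambda>b. {e \<in> all_edges {..<n}. b e})
       (Pi_pmf (all_edges {..<n}) False (\<lambda>_. bernoulli_pmf p))"

lemma equiv_cut_equiv: "equiv V (cut_equiv r V E)"
  by (rule equivI) (auto simp: cut_equiv_def refl_on_def sym_def trans_def)

lemma is_core_unique:
  assumes fin: "finite V" and K: "is_core r V E K" and L: "is_core r V E L"
  shows "K = L"
proof -
  have "K \<subseteq> L"
  proof (rule ccontr)
    assume "\<not> K \<subseteq> L"
    then obtain C where C: "C \<in> K" "C \<notin> L" by auto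
    define M where "M = insert C L"
    have M: "finite M" "card M = r + 1" "M \<subseteq> cut_components r V E"
      using C K L by (auto simp: M_def is_core_def)
    have big: "real (card D) > real (card V) / (real r + 1)" if "D \<in> M" for D
      using that C K L by (auto simp: M_def is_core_def)
    have sub: "D \<subseteq> V" if "D \<in> M" for D
      using that M(3) equiv_cut_equiv[of V r E] in_quotient_imp_subset
      unfolding cut_components_def by blast
    have disj: "pairwise disjnt M"
      using M(3) quotient_disj[OF equiv_cut_equiv[of V r E]]
      unfolding cut_components_def pairwise_def disjnt_def by blast
    have "M \<noteq> {}" by (simp add: M_def)
    have "real (card V) = (\<Sum>D\<in>M. real (card V) / (real r + 1))"
      using M(2) by (simp add: field_simps)
    also have "\<dots> < (\<Sum>D\<in>M. real (card D))"
      using M(1) \<open>M \<noteq> {}\<close> big by (intro sum_strict_mono) auto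
    also have "\<dots> = real (card (\<Union>M))"
      using disj sub fin by (subst card_Union_disjoint) (auto intro: finite_subset)
    also have "\<dots> \<le> real (card V)"
      using sub fin by (auto intro!: card_mono)
    finally show False by simp
  qed
  then show ?thesis
    using K L by (intro card_subset_eq) (auto simp: is_core_def)
qed

end

theory Submission
  imports Defs
begin

text \<open>
  Write \<open>G\<close> for the random graph, \<open>X\<close> for the set of vertices outside its core, \<open>x\<close> for the mean
  of \<open>|X|\<close>, and call a pair \<open>e\<close> of vertices slack if \<open>G + e\<close> and \<open>G - e\<close> have maximum cuts of the
  same size. Slackness of \<open>e\<close> is independent of the event \<open>e \<in> G\<close>, so the mean number of slack
  edges is exactly \<open>p\<close> times the mean number of slack pairs (\<open>mean_slack_edges\<close>). If \<open>X\<close> were small,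
  this identity would fail, because a maximum cut has fewer edges inside its parts than density
  \<open>p\<close> predicts.

  On the one hand, every pair inside a core component is slack, and by convexity there are at
  least \<open>n\<^sup>2 / (2 r) - n |X| / r - n / 2\<close> such pairs (\<open>card_slack_ge\<close>). On the other hand, a slack edge
  is left unseparated by some maximum cut of \<open>G\<close>. Fix one maximum cut. Apart from the edges inside
  its parts, a slack edge either touches \<open>X\<close> or joins two core components that another maximum
  cut merges into one part. In the latter case that cut has a part containing no core component,
  and moving one of the two components there shows that the edges between them are at most as
  many as the edges touching \<open>X\<close> (\<open>card_edges_between_merged_components\<close>). Hence the number of
  slack edges is at most \<open>|G|\<close> minus the size of a maximum cut plus \<open>1 + r\<^sup>2\<close> times the number of
  edges touching \<open>X\<close> (\<open>card_slack_edges_le\<close>), and the mean of the last number is at most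
  \<open>2 n p x + n\<close> (\<open>mean_card_edges_touching_exterior\<close>).

  Finally, add the vertices one at a time, extending a maximum cut each time by putting the new
  vertex into the part containing the fewest of its neighbours. This shows that a maximum cut
  exceeds the trivial fraction \<open>1 - 1 / r\<close> of the edges by a constant times \<open>n * sqrt (n p)\<close> on
  average (\<open>mean_maxcut_ge\<close>, \<open>sum_greedy_gain_ge\<close>); the fluctuation that this exploits comes from a
  fourth-moment bound and needs \<open>p\<close> to stay away from 1. Combining the estimates, \<open>n * sqrt (n p)\<close> is at most a constant times \<open>n p x + n\<close>, and since \<open>n p\<close> tends to
  infinity, \<open>x\<close> is at least a constant times \<open>sqrt (n p) / p = sqrt (n / p)\<close>.
\<close>

section \<open>Mean over binomial random subsets\<close>

text \<open>
  The mean of \<open>F T\<close> when \<open>T\<close> contains each element of \<open>S\<close> independently with probability \<open>p\<close>,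
  written as a finite sum so that \<open>S\<close> can be built up one element at a time.
\<close>

definition bmean :: "real \<Rightarrow> 'a set \<Rightarrow> ('a set \<Rightarrow> real) \<Rightarrow> real" where
  "bmean p S F = (\<Sum>T\<in>Pow S. p ^ card T * (1 - p) ^ card (S - T) * F T)"

lemma bmean_empty [simp]: "bmean p {} F = F {}"
  by (simp add: bmean_def)

lemma bmean_cong: "(\<And>T. T \<subseteq> S \<Longrightarrow> F T = G T) \<Longrightarrow> bmean p S F = bmean p S G"
  unfolding bmean_def by (intro sum.cong) auto

lemma bmean_insert:
  assumes "finite S" "x \<notin> S"
  shows "bmean p (insert x S) F = p * bmean p S (\<lambda>T. F (insert x T)) + (1 - p) * bmean p S F"
proof -
  let ?w = "\<lambda>T. p ^ card T * (1 - p) ^ card (insert x S - T) * F T"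
  have inj: "inj_on (insert x) (Pow S)"
    using assms(2) by (auto simp: inj_on_def)
  have "bmean p (insert x S) F = sum ?w (Pow S) + sum ?w (insert x ` Pow S)"
    unfolding bmean_def Pow_insert using assms by (intro sum.union_disjoint) auto
  moreover have "sum ?w (Pow S) = (1 - p) * bmean p S F"
    unfolding bmean_def sum_distrib_left
  proof (rule sum.cong)
    fix T assume T: "T \<in> Pow S"
    have "insert x S - T = insert x (S - T)" using T assms by auto
    moreover have "card (insert x (S - T)) = Suc (card (S - T))"
      using assms by (intro card_insert_disjoint) auto
    ultimately show "?w T = (1 - p) * (p ^ card T * (1 - p) ^ card (S - T) * F T)" by simp
  qed auto
  moreover have "sum ?w (insert x ` Pow S) = p * bmean p S (\<lambda>T. F (insert x T))"
    unfolding bmean_def sum_distrib_left sum.reindex[OF inj] o_def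
  proof (rule sum.cong)
    fix T assume T: "T \<in> Pow S"
    have "insert x S - insert x T = S - T" using T assms by auto
    moreover have "card (insert x T) = Suc (card T)"
      using T assms by (intro card_insert_disjoint) (auto intro: finite_subset)
    ultimately show "?w (insert x T) = p * (p ^ card T * (1 - p) ^ card (S - T) * F (insert x T))"
      by simp
  qed auto
  ultimately show ?thesis by simp
qed

lemma bmean_const [simp]: "finite S \<Longrightarrow> bmean p S (\<lambda>_. c) = c"
  by (induction S rule: finite_induct) (simp_all add: bmean_insert algebra_simps)

lemma bmean_add: "bmean p S (\<lambda>T. F T + G T) = bmean p S F + bmean p S G"
  by (simp add: bmean_def sum.distrib algebra_simps)

lemma bmean_cmult: "bmean p S (\<lambda>T. c * F T) = c * bmean p S F"
  by (simp add: bmean_def sum_distrib_left algebra_simps)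

lemma bmean_diff: "bmean p S (\<lambda>T. F T - G T) = bmean p S F - bmean p S G"
  by (simp add: bmean_def sum_subtractf algebra_simps)

lemma bmean_sum: "bmean p S (\<lambda>T. \<Sum>i\<in>I. F i T) = (\<Sum>i\<in>I. bmean p S (F i))"
  unfolding bmean_def sum_distrib_left by (rule sum.swap)

lemma bmean_mono:
  assumes "0 \<le> p" "p \<le> 1" "\<And>T. T \<subseteq> S \<Longrightarrow> F T \<le> G T"
  shows "bmean p S F \<le> bmean p S G"
  unfolding bmean_def using assms by (intro sum_mono mult_left_mono) auto

lemma bmean_union:
  assumes "finite R" "finite S" "R \<inter> S = {}"
  shows "bmean p (R \<union> S) F = bmean p R (\<lambda>A. bmean p S (\<lambda>B. F (A \<union> B)))"
  using assms
proof (induction R arbitrary: F rule: finite_induct)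
  case (insert x R)
  have "bmean p (insert x (R \<union> S)) F
      = p * bmean p (R \<union> S) (\<lambda>T. F (insert x T)) + (1 - p) * bmean p (R \<union> S) F"
    using insert by (intro bmean_insert) auto
  with insert show ?case by (simp add: bmean_insert)
qed auto

lemma bmean_image:
  assumes "finite S" "inj_on h S"
  shows "bmean p (h ` S) F = bmean p S (\<lambda>T. F (h ` T))"
  using assms
proof (induction S arbitrary: F rule: finite_induct)
  case (insert x S)
  have "bmean p (insert (h x) (h ` S)) F
      = p * bmean p (h ` S) (\<lambda>T. F (insert (h x) T)) + (1 - p) * bmean p (h ` S) F"
    using insert by (intro bmean_insert) auto
  with insert show ?case by (simp add: bmean_insert)
qed auto

text \<open>The event \<open>x \<in> T\<close> is independent of every function of \<open>T - {x}\<close>.\<close>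

lemma bmean_independent:
  assumes "finite S" "x \<in> S"
  shows "bmean p S (\<lambda>T. of_bool (x \<in> T) * F (T - {x})) = p * bmean p S (\<lambda>T. F (T - {x}))"
proof -
  define R where "R = S - {x}"
  have R: "S = insert x R" "x \<notin> R" "finite R" using assms by (auto simp: R_def)
  have 1: "bmean p R (\<lambda>T. of_bool (x \<in> T) * F (T - {x})) = bmean p R (\<lambda>T. 0)"
    using R by (intro bmean_cong) auto
  have 2: "bmean p R (\<lambda>T. F (T - {x})) = bmean p R F"
    using R by (intro bmean_cong arg_cong[of _ _ F]) auto
  have 3: "bmean p R (\<lambda>T. F (insert x T - {x})) = bmean p R F"
    using R by (intro bmean_cong arg_cong[of _ _ F]) auto
  from 1 2 3 show ?thesis
    unfolding R(1) bmean_insert[OF R(3,2)] using R by (simp add: algebra_simps)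
qed

lemma bmean_mem: "finite S \<Longrightarrow> x \<in> S \<Longrightarrow> bmean p S (\<lambda>T. of_bool (x \<in> T)) = p"
  using bmean_independent[of S x p "\<lambda>_. 1"] by simp

lemma bmean_card:
  assumes "finite S"
  shows "bmean p S (\<lambda>T. real (card T)) = p * real (card S)"
proof -
  have "bmean p S (\<lambda>T. real (card T)) = bmean p S (\<lambda>T. \<Sum>x\<in>S. of_bool (x \<in> T))"
    using assms by (intro bmean_cong) (simp add: Int_absorb1)
  then show ?thesis
    using assms by (simp add: bmean_sum bmean_mem del: sum_of_bool_eq)
qed

lemma expectation_Pi_bernoulli:
  assumes "finite S" "0 \<le> p" "p \<le> 1"
  shows "measure_pmf.expectation (Pi_pmf S False (\<lambda>_. bernoulli_pmf p)) (\<lambda>b. F {x \<in> S. b x})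
    = bmean p S F"
  using assms
proof (induction S arbitrary: F rule: finite_induct)
  case empty
  then show ?case by simp
next
  case (insert x S)
  let ?P = "Pi_pmf S False (\<lambda>_. bernoulli_pmf p)"
  have fin: "finite (set_pmf ?P)"
    using insert by (intro finite_subset[OF set_Pi_pmf_subset'] finite_PiE_dflt) auto
  have "Pi_pmf (insert x S) False (\<lambda>_. bernoulli_pmf p)
      = bernoulli_pmf p \<bind> (\<lambda>a. map_pmf (\<lambda>f. f(x := a)) ?P)"
    using insert by (simp add: Pi_pmf_insert' map_pmf_def)
  then have "measure_pmf.expectation (Pi_pmf (insert x S) False (\<lambda>_. bernoulli_pmf p))
      (\<lambda>b. F {y \<in> insert x S. b y})
    = p * measure_pmf.expectation ?P (\<lambda>f. F {y \<in> insert x S. (f(x := True)) y})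
      + (1 - p) * measure_pmf.expectation ?P (\<lambda>f. F {y \<in> insert x S. (f(x := False)) y})"
    using insert.prems fin
    by (simp only:) (subst pmf_expectation_bind[where A = UNIV], auto simp: UNIV_bool)
  also have "\<dots> = p * bmean p S (\<lambda>T. F (insert x T)) + (1 - p) * bmean p S F"
  proof -
    have "{y \<in> insert x S. (f(x := True)) y} = insert x {y \<in> S. f y}" for f
      using insert by auto
    moreover have "{y \<in> insert x S. (f(x := False)) y} = {y \<in> S. f y}" for f
      using insert by auto
    ultimately show ?thesis
      using insert.prems insert.IH[of F] insert.IH[of "\<lambda>T. F (insert x T)"] by simp
  qed
  finally show ?case using insert by (simp add: bmean_insert)
qed

lemma finite_all_edges: "finite V \<Longrightarrow> finite (all_edges V)"
  by (auto simp: all_edges_def intro: finite_subset[of _ "Pow V"])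

lemma expectation_binomial_graph:
  assumes "0 \<le> p" "p \<le> 1"
  shows "measure_pmf.expectation (binomial_graph n p) F = bmean p (all_edges {..<n}) F"
  unfolding binomial_graph_def integral_map_pmf
  using assms by (intro expectation_Pi_bernoulli) (auto simp: finite_all_edges)

section \<open>Moments of weighted counts\<close>

text \<open>The centred weighted number of elements of the random set.\<close>

definition centred :: "('a \<Rightarrow> real) \<Rightarrow> real \<Rightarrow> 'a set \<Rightarrow> 'a set \<Rightarrow> real" where
  "centred w p S T = (\<Sum>x\<in>S. w x * (of_bool (x \<in> T) - p))"

lemma centred_insert:
  assumes "finite S" "x \<notin> S" "T \<subseteq> S"
  shows "centred w p (insert x S) (insert x T) = centred w p S T + w x * (1 - p)"
    and "centred w p (insert x S) T = centred w p S T - w x * p"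
proof -
  have "(\<Sum>y\<in>S. w y * (of_bool (y \<in> insert x T) - p)) = (\<Sum>y\<in>S. w y * (of_bool (y \<in> T) - p))"
    using assms by (intro sum.cong) auto
  then show "centred w p (insert x S) (insert x T) = centred w p S T + w x * (1 - p)"
    using assms by (simp add: centred_def)
  show "centred w p (insert x S) T = centred w p S T - w x * p"
    using assms by (auto simp: centred_def algebra_simps)
qed

lemma bmean_centred_insert:
  assumes "finite S" "x \<notin> S"
  shows "bmean p (insert x S) (\<lambda>T. F (centred w p (insert x S) T))
    = bmean p S (\<lambda>T. p * F (centred w p S T + w x * (1 - p)) + (1 - p) * F (centred w p S T - w x * p))"
proof -
  have "bmean p S (\<lambda>T. F (centred w p (insert x S) (insert x T)))
      = bmean p S (\<lambda>T. F (centred w p S T + w x * (1 - p)))"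
    using assms by (intro bmean_cong) (simp add: centred_insert)
  moreover have "bmean p S (\<lambda>T. F (centred w p (insert x S) T))
      = bmean p S (\<lambda>T. F (centred w p S T - w x * p))"
    using assms by (intro bmean_cong) (simp add: centred_insert)
  ultimately show ?thesis
    using assms by (simp add: bmean_insert bmean_add bmean_cmult)
qed

lemma mean_centred: "finite S \<Longrightarrow> bmean p S (centred w p S) = 0"
proof (induction S rule: finite_induct)
  case (insert x S)
  show ?case
    using bmean_centred_insert[OF insert(1,2), of p "\<lambda>y. y" w] insert
    by (simp add: algebra_simps bmean_add bmean_diff bmean_cmult)
qed (simp add: centred_def)

lemma second_moment_centred:
  "finite S \<Longrightarrow> bmean p S (\<lambda>T. (centred w p S T)\<^sup>2) = p * (1 - p) * (\<Sum>x\<in>S. (w x)\<^sup>2)"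
proof (induction S rule: finite_induct)
  case (insert x S)
  have "bmean p (insert x S) (\<lambda>T. (centred w p (insert x S) T)\<^sup>2)
      = bmean p S (\<lambda>T. (centred w p S T)\<^sup>2 + p * (1 - p) * (w x)\<^sup>2)"
    unfolding bmean_centred_insert[OF insert(1,2), of p "\<lambda>y. y\<^sup>2" w]
    by (intro bmean_cong) (simp add: power2_eq_square algebra_simps)
  then show ?case using insert by (simp add: bmean_add distrib_left)
qed (simp add: centred_def)

lemma fourth_moment_centred:
  assumes "finite S" "0 \<le> p" "p \<le> 1" "\<And>x. x \<in> S \<Longrightarrow> \<bar>w x\<bar> \<le> 1"
  defines "s \<equiv> \<lambda>S. p * (1 - p) * (\<Sum>x\<in>S. (w x)\<^sup>2)"
  shows "bmean p S (\<lambda>T. (centred w p S T) ^ 4) \<le> 3 * (s S)\<^sup>2 + s S"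
  using assms(1,4)
proof (induction S rule: finite_induct)
  case empty
  then show ?case by (simp add: centred_def s_def)
next
  case (insert x S)
  define v where "v = p * (1 - p) * (w x)\<^sup>2"
  define k where "k = p * (w x * (1 - p)) ^ 3 + (1 - p) * (- (w x * p)) ^ 3"
  have w2: "(w x)\<^sup>2 \<le> 1" using insert.prems by (simp add: abs_square_le_1)
  have v0: "0 \<le> v" using assms(2,3) by (simp add: v_def)
  have "(1 - p) ^ 3 + p ^ 3 \<le> (1 - p) + p"
    using assms(2,3) power_decreasing[of 1 3 p] power_decreasing[of 1 3 "1 - p"] by simp
  then have "(w x)\<^sup>2 * ((1 - p) ^ 3 + p ^ 3) \<le> 1 * 1"
    using w2 assms(2,3) by (intro mult_mono) auto
  then have "v * ((w x)\<^sup>2 * ((1 - p) ^ 3 + p ^ 3)) \<le> v * 1"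
    using v0 by (intro mult_left_mono) auto
  moreover have "p * (w x * (1 - p)) ^ 4 + (1 - p) * (w x * p) ^ 4
      = v * ((w x)\<^sup>2 * ((1 - p) ^ 3 + p ^ 3))"
    unfolding v_def by algebra
  ultimately have q: "p * (w x * (1 - p)) ^ 4 + (1 - p) * (w x * p) ^ 4 \<le> v" by simp
  have "p * (y + w x * (1 - p)) ^ 4 + (1 - p) * (y - w x * p) ^ 4
      = y ^ 4 + 6 * v * y\<^sup>2 + 4 * k * y
        + (p * (w x * (1 - p)) ^ 4 + (1 - p) * (w x * p) ^ 4)" for y
    unfolding v_def k_def by algebra
  then have step: "p * (y + w x * (1 - p)) ^ 4 + (1 - p) * (y - w x * p) ^ 4
      \<le> y ^ 4 + 6 * v * y\<^sup>2 + 4 * k * y + v" for y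
    using q by simp
  have "bmean p (insert x S) (\<lambda>T. (centred w p (insert x S) T) ^ 4)
      \<le> bmean p S (\<lambda>T. (centred w p S T) ^ 4 + 6 * v * (centred w p S T)\<^sup>2
          + 4 * k * centred w p S T + v)"
    unfolding bmean_centred_insert[OF insert(1,2), of p "\<lambda>y. y ^ 4" w]
    using assms(2,3) step by (intro bmean_mono) auto
  also have "\<dots> \<le> 3 * (s S)\<^sup>2 + s S + 6 * v * s S + v"
    using insert by (simp add: bmean_add bmean_cmult mean_centred second_moment_centred s_def)
  also have "\<dots> \<le> 3 * (s S + v)\<^sup>2 + (s S + v)"
    using v0 by (simp add: power2_eq_square algebra_simps)
  also have "s S + v = s (insert x S)"
    using insert by (simp add: s_def v_def algebra_simps)
  finally show ?case .
qed

text \<open>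
  A variance \<open>s \<ge> 1\<close> forces a mean absolute value of order \<open>sqrt s\<close>, because the fourth moment is at
  most \<open>4 * s\<^sup>2\<close>.
\<close>

lemma mean_abs_centred:
  assumes "finite S" "0 \<le> p" "p \<le> 1" "\<And>x. x \<in> S \<Longrightarrow> \<bar>w x\<bar> \<le> 1"
    and "s = p * (1 - p) * (\<Sum>x\<in>S. (w x)\<^sup>2)" "1 \<le> s"
  shows "3 / 16 * sqrt s \<le> bmean p S (\<lambda>T. \<bar>centred w p S T\<bar>)"
proof -
  define t where "t = 4 * sqrt s"
  have t: "t > 0" using assms(6) by (simp add: t_def)
  \<comment> \<open>The absolute value is bounded below by a polynomial whose mean is controlled by the moments.\<close>
  have low: "y\<^sup>2 / t - y ^ 4 / t ^ 3 \<le> \<bar>y\<bar>" for y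
  proof -
    define z where "z = \<bar>y\<bar> / t"
    have z: "0 \<le> z" using t by (simp add: z_def)
    have "z\<^sup>2 - z ^ 4 \<le> z"
    proof (cases "z \<le> 1")
      case True
      then have "z\<^sup>2 \<le> z" using z by (simp add: power2_eq_square mult_left_le)
      then show ?thesis using z by (simp add: add_increasing2 diff_le_eq)
    next
      case False
      then have "z\<^sup>2 \<le> z ^ 4" by (intro power_increasing) auto
      then show ?thesis using z by simp
    qed
    then have "t * (z\<^sup>2 - z ^ 4) \<le> t * z" using t by (intro mult_left_mono) auto
    moreover have "t * z = \<bar>y\<bar>" using t by (simp add: z_def)
    moreover have "t * (z\<^sup>2 - z ^ 4) = y\<^sup>2 / t - y ^ 4 / t ^ 3"
      using t by (simp add: z_def power_divide field_simps eval_nat_numeral)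
    ultimately show ?thesis by simp
  qed
  have m4: "bmean p S (\<lambda>T. (centred w p S T) ^ 4) \<le> 4 * s\<^sup>2"
  proof -
    have "bmean p S (\<lambda>T. (centred w p S T) ^ 4) \<le> 3 * s\<^sup>2 + s"
      unfolding assms(5) using assms(1-4) by (intro fourth_moment_centred) auto
    moreover have "s \<le> s\<^sup>2" using assms(6) by (simp add: power2_eq_square)
    ultimately show ?thesis by simp
  qed
  have rs: "sqrt s > 0" "s = (sqrt s)\<^sup>2" using assms(6) by auto
  have "s / t - 4 * s\<^sup>2 / t ^ 3 = 3 / 16 * sqrt s"
  proof -
    define q where "q = sqrt s"
    have "q > 0" "s = q\<^sup>2" using rs by (auto simp: q_def)
    then show ?thesis unfolding t_def q_def[symmetric]
      by (simp add: field_simps eval_nat_numeral)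
  qed
  then have "3 / 16 * sqrt s = s / t - 4 * s\<^sup>2 / t ^ 3" by simp
  also have "\<dots> \<le> s / t - bmean p S (\<lambda>T. (centred w p S T) ^ 4) / t ^ 3"
    using m4 t by (intro diff_left_mono divide_right_mono) auto
  also have "\<dots> = bmean p S (\<lambda>T. 1 / t * (centred w p S T)\<^sup>2 - 1 / t ^ 3 * (centred w p S T) ^ 4)"
    unfolding bmean_diff bmean_cmult using assms(1,5) by (simp add: second_moment_centred)
  also have "\<dots> \<le> bmean p S (\<lambda>T. \<bar>centred w p S T\<bar>)"
    using assms(2,3) low by (intro bmean_mono) auto
  finally show ?thesis .
qed

section \<open>A greedy lower bound for the maximum cut\<close>

text \<open>
  The size of the smallest of the \<open>r\<close> classes of \<open>T\<close>, when \<open>g\<close> assigns to each element the index of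
  its class. Empty classes count.
\<close>

definition least_class :: "nat \<Rightarrow> ('a \<Rightarrow> nat) \<Rightarrow> 'a set \<Rightarrow> nat" where
  "least_class r g T = Min ((\<lambda>i. card {x \<in> T. g x = i}) ` {..<r})"

text \<open>
  How much the mean size of the smallest of \<open>r\<close> classes is guaranteed to fall below the average
  class size when each of \<open>m\<close> elements is selected with probability \<open>p\<close>: a constant depending on
  \<open>r\<close>, times the standard deviation of the number of selected elements in a class of size \<open>m / r\<close>,
  provided that the variance of this number is at least 1.
\<close>

definition greedy_gain :: "real \<Rightarrow> nat \<Rightarrow> nat \<Rightarrow> real" where
  "greedy_gain p r m = (if 1 \<le> p * (1 - p) * real m / real r
     then 3 / (32 * real r) * sqrt (p * (1 - p) * real m / real r) else 0)"

lemma sum_card_classes: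
  assumes "finite T" "g \<in> T \<rightarrow> I" "finite I"
  shows "(\<Sum>i\<in>I. card {x \<in> T. g x = i}) = card T"
proof -
  have "card (\<Union>i\<in>I. {x \<in> T. g x = i}) = (\<Sum>i\<in>I. card {x \<in> T. g x = i})"
    using assms by (intro card_UN_disjoint) auto
  moreover have "(\<Union>i\<in>I. {x \<in> T. g x = i}) = T" using assms by auto
  ultimately show ?thesis by simp
qed

text \<open>
  Comparing class \<open>j\<close> with the average of the other classes gives a quantitative bound on the
  smallest class in terms of a single signed count.
\<close>

lemma least_class_le:
  fixes r :: nat
  assumes "finite T" "g \<in> T \<rightarrow> {..<r}" "r \<ge> 2" "j < r"
  shows "real (least_class r g T)
    \<le> real (card T) / r - \<bar>\<Sum>x\<in>T. if g x = j then 1 else - 1 / (real r - 1)\<bar> / r"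
proof -
  define Y where "Y = real (card {x \<in> T. g x = j})"
  define Z where "Z = (real (card T) - Y) / (real r - 1)"
  have r: "real r \<ge> 2" using assms(3) by simp
  have le: "real (least_class r g T) \<le> real (card {x \<in> T. g x = i})" if "i < r" for i
    unfolding least_class_def using that by (auto intro: Min_le)
  have "(\<Sum>i<r. real (card {x \<in> T. g x = i})) = real (card T)"
    using sum_card_classes[OF assms(1,2)] by (simp flip: of_nat_sum)
  then have "(\<Sum>i\<in>{..<r} - {j}. real (card {x \<in> T. g x = i})) = real (card T) - Y"
    using assms(4) by (simp add: sum_diff1 Y_def)
  moreover have "(\<Sum>i\<in>{..<r} - {j}. real (least_class r g T))
      \<le> (\<Sum>i\<in>{..<r} - {j}. real (card {x \<in> T. g x = i}))"
    by (intro sum_mono le) auto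
  ultimately have "(real r - 1) * real (least_class r g T) \<le> real (card T) - Y"
    using assms(4) by (simp add: of_nat_diff)
  then have "real (least_class r g T) \<le> Z" using r by (simp add: Z_def field_simps)
  moreover have "real (least_class r g T) \<le> Y" unfolding Y_def using le assms(4) by simp
  moreover have "min Y Z \<le> real (card T) / r - \<bar>Y - Z\<bar> / r"
  proof -
    have c: "real (card T) = Y + (real r - 1) * Z" using r by (simp add: Z_def)
    have "(real r - 2) * min Y Z \<le> (real r - 2) * Z" using r by (intro mult_left_mono) auto
    then have "real r * min Y Z \<le> real (card T) - \<bar>Y - Z\<bar>"
      unfolding c by (cases "Y \<le> Z") (simp_all add: algebra_simps)
    then show ?thesis using r by (simp add: field_simps)
  qed
  ultimately have "real (least_class r g T) \<le> real (card T) / r - \<bar>Y - Z\<bar> / r" by linarith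
  moreover have "(\<Sum>x\<in>T. if g x = j then 1 else - 1 / (real r - 1)) = Y - Z"
  proof -
    have "T - {x \<in> T. g x = j} = {x \<in> T. g x \<noteq> j}" by auto
    then have "real (card {x \<in> T. g x \<noteq> j}) = real (card T) - Y"
      using card_Diff_subset[of "{x \<in> T. g x = j}" T] assms(1)
      by (simp add: Y_def of_nat_diff card_mono)
    moreover have "(\<Sum>x\<in>T. if g x = j then 1 else - 1 / (real r - 1))
        = (\<Sum>x\<in>{x \<in> T. g x = j}. 1) + (\<Sum>x\<in>{x \<in> T. g x \<noteq> j}. - 1 / (real r - 1))"
      using assms(1) by (simp add: sum.If_cases Int_def)
    ultimately show ?thesis by (simp add: Y_def Z_def)
  qed
  ultimately show ?thesis by (simp only:)
qed

lemma mean_least_class: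
  fixes r :: nat
  assumes "finite S" "g \<in> S \<rightarrow> {..<r}" "r \<ge> 2" "0 \<le> p" "p \<le> 1"
  shows "bmean p S (\<lambda>T. real (least_class r g T)) \<le> p * card S / r - greedy_gain p r (card S)"
proof -
  have r: "real r \<ge> 2" using assms(3) by simp
  \<comment> \<open>A class \<open>j\<close> of at least average size makes the variance of the signed count at least that of \<open>card S / r\<close> elements.\<close>
  have "\<exists>j<r. real (card S) / r \<le> real (card {x \<in> S. g x = j})"
  proof (rule ccontr)
    assume no: "\<not> ?thesis"
    have "real (card {x \<in> S. g x = i}) < real (card S) / r" if "i < r" for i
      using no that by (metis not_le)
    then have "(\<Sum>i<r. real (card {x \<in> S. g x = i})) < (\<Sum>i<r. real (card S) / r)"
      using assms(3) by (intro sum_strict_mono) (auto simp: lessThan_empty_iff)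
    then show False
      using sum_card_classes[OF assms(1,2)] r by (simp flip: of_nat_sum)
  qed
  then obtain j where j: "j < r" "real (card S) / r \<le> real (card {x \<in> S. g x = j})" by auto
  define w where "w = (\<lambda>x. if g x = j then 1 else - 1 / (real r - 1))"
  have w1: "\<bar>w x\<bar> \<le> 1" for x using r by (simp add: w_def)
  define W where "W = (\<lambda>T. centred w p S T + p * (\<Sum>x\<in>S. w x))"
  have W: "(\<Sum>x\<in>T. w x) = W T" if "T \<subseteq> S" for T
  proof -
    have "(\<Sum>x\<in>S. w x * of_bool (x \<in> T)) = (\<Sum>x\<in>S. if x \<in> T then w x else 0)"
      by (intro sum.cong) auto
    also have "\<dots> = (\<Sum>x\<in>T. w x)"
      using assms(1) that by (simp add: sum.If_cases Int_absorb1)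
    finally show ?thesis
      by (simp add: W_def centred_def right_diff_distrib sum_subtractf sum_distrib_left mult.commute)
  qed
  \<comment> \<open>\<open>W\<close> is compared with its deviation from its own mean, so the mean need not be known.\<close>
  have EW: "bmean p S W = p * (\<Sum>x\<in>S. w x)"
    using assms(1) by (simp add: W_def bmean_add mean_centred)
  define a where "a = bmean p S (\<lambda>T. \<bar>W T\<bar>)"
  have "\<bar>p * (\<Sum>x\<in>S. w x)\<bar> \<le> a"
  proof -
    have "bmean p S W \<le> a" unfolding a_def using assms by (intro bmean_mono) auto
    moreover have "bmean p S (\<lambda>T. - 1 * W T) \<le> a"
      unfolding a_def using assms by (intro bmean_mono) auto
    ultimately show ?thesis unfolding bmean_cmult EW by linarith
  qed
  moreover have "bmean p S (\<lambda>T. \<bar>centred w p S T\<bar>)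
      \<le> bmean p S (\<lambda>T. \<bar>W T\<bar> + \<bar>p * (\<Sum>x\<in>S. w x)\<bar>)"
    using assms by (intro bmean_mono) (auto simp: W_def)
  ultimately have half: "bmean p S (\<lambda>T. \<bar>centred w p S T\<bar>) / 2 \<le> a"
    using assms(1) by (simp add: bmean_add a_def)
  have "0 \<le> a"
    using bmean_mono[of p S "\<lambda>_. 0" "\<lambda>T. \<bar>W T\<bar>"] assms by (simp add: a_def)
  have "r * greedy_gain p r (card S) \<le> a"
  proof (cases "1 \<le> p * (1 - p) * real (card S) / real r")
    case True
    define s where "s = p * (1 - p) * (\<Sum>x\<in>S. (w x)\<^sup>2)"
    have "real (card S) / r \<le> (\<Sum>x\<in>{x \<in> S. g x = j}. (w x)\<^sup>2)"
      using j(2) by (simp add: w_def)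
    also have "\<dots> \<le> (\<Sum>x\<in>S. (w x)\<^sup>2)"
      using assms(1) by (intro sum_mono2) auto
    finally have "p * (1 - p) * (real (card S) / r) \<le> s"
      unfolding s_def using assms by (intro mult_left_mono) auto
    then have s: "p * (1 - p) * card S / r \<le> s" by simp
    then have "3 / 16 * sqrt s \<le> bmean p S (\<lambda>T. \<bar>centred w p S T\<bar>)"
      using assms w1 order_trans[OF True s] by (intro mean_abs_centred) (auto simp: s_def)
    then have "3 / 32 * sqrt s \<le> a" using half by simp
    moreover have "sqrt (p * (1 - p) * card S / r) \<le> sqrt s" using s by simp
    ultimately have "3 / 32 * sqrt (p * (1 - p) * card S / r) \<le> a" by linarith
    then show ?thesis using True r by (simp add: greedy_gain_def)
  next
    case False
    then have "greedy_gain p r (card S) = 0" unfolding greedy_gain_def by (rule if_not_P)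
    then show ?thesis using \<open>0 \<le> a\<close> by simp
  qed
  then have gain: "greedy_gain p r (card S) \<le> a / r" using r by (simp add: field_simps)
  have "bmean p S (\<lambda>T. real (least_class r g T))
      \<le> bmean p S (\<lambda>T. 1 / r * real (card T) - 1 / r * \<bar>W T\<bar>)"
  proof (rule bmean_mono)
    fix T assume T: "T \<subseteq> S"
    have "real (least_class r g T) \<le> real (card T) / r - \<bar>\<Sum>x\<in>T. w x\<bar> / r"
      unfolding w_def using T assms j by (intro least_class_le) (auto intro: finite_subset)
    then show "real (least_class r g T) \<le> 1 / r * real (card T) - 1 / r * \<bar>W T\<bar>"
      using W[OF T] by simp
  qed (use assms in auto)
  also have "\<dots> = p * card S / r - a / r"
    unfolding bmean_diff bmean_cmult a_def using assms(1) by (simp add: bmean_card)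
  finally show ?thesis using gain by linarith
qed

text \<open>The size of a maximum cut.\<close>

definition maxcut :: "nat \<Rightarrow> 'a set \<Rightarrow> 'a set set \<Rightarrow> nat" where
  "maxcut r V E = Max (cut_size E ` cuts r V)"

lemma finite_cuts: "finite V \<Longrightarrow> finite (cuts r V)"
  by (simp add: cuts_def finite_PiE)

lemma cuts_nonempty: "0 < r \<Longrightarrow> cuts r V \<noteq> {}"
  by (auto simp: cuts_def PiE_eq_empty_iff)

lemma cut_size_le_maxcut: "finite V \<Longrightarrow> f \<in> cuts r V \<Longrightarrow> cut_size E f \<le> maxcut r V E"
  by (simp add: maxcut_def finite_cuts)

lemma max_cuts_iff:
  assumes "finite V" "0 < r"
  shows "f \<in> max_cuts r V E \<longleftrightarrow> f \<in> cuts r V \<and> cut_size E f = maxcut r V E"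
proof -
  have "maxcut r V E \<in> cut_size E ` cuts r V"
    unfolding maxcut_def using assms by (intro Max_in) (auto simp: finite_cuts cuts_nonempty)
  then show ?thesis
    unfolding max_cuts_def using cut_size_le_maxcut[OF assms(1), of _ r E]
    by (auto intro: le_antisym)
qed

lemma max_cut_exists:
  assumes "finite V" "0 < r"
  obtains f where "f \<in> cuts r V" "cut_size E f = maxcut r V E"
proof -
  have "maxcut r V E \<in> cut_size E ` cuts r V"
    unfolding maxcut_def using assms by (intro Max_in) (auto simp: finite_cuts cuts_nonempty)
  then show ?thesis using that by auto
qed

lemma all_edges_Suc:
  "all_edges {..<Suc m} = all_edges {..<m} \<union> (\<lambda>u. {u, m}) ` {..<m}"
  "all_edges {..<m} \<inter> (\<lambda>u. {u, m}) ` {..<m} = {}"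
proof -
  have "e \<in> all_edges {..<m} \<union> (\<lambda>u. {u, m}) ` {..<m}" if e: "e \<in> all_edges {..<Suc m}" for e
  proof (cases "m \<in> e")
    case True
    then obtain u where "e = {u, m}" "u \<noteq> m"
      using e by (auto simp: all_edges_def card_2_iff)
    then show ?thesis using e by (auto simp: all_edges_def)
  next
    case False
    then show ?thesis using e by (auto simp: all_edges_def less_Suc_eq)
  qed
  then show "all_edges {..<Suc m} = all_edges {..<m} \<union> (\<lambda>u. {u, m}) ` {..<m}"
    by (auto simp: all_edges_def)
  show "all_edges {..<m} \<inter> (\<lambda>u. {u, m}) ` {..<m} = {}"
    by (auto simp: all_edges_def)
qed

text \<open>A new vertex may be added to the part that contains the fewest of its neighbours.\<close>

lemma maxcut_add_vertex:
  assumes "0 < r" "A \<subseteq> all_edges {..<m}" "T \<subseteq> {..<m}" "f \<in> cuts r {..<m}"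
    "cut_size A f = maxcut r {..<m} A"
  shows "maxcut r {..<m} A + card T
    \<le> maxcut r {..<Suc m} (A \<union> (\<lambda>u. {u, m}) ` T) + least_class r f T"
proof -
  let ?st = "\<lambda>u. {u, m}"
  have "least_class r f T \<in> (\<lambda>i. card {x \<in> T. f x = i}) ` {..<r}"
    unfolding least_class_def using assms(1) by (intro Min_in) auto
  then obtain i where i: "i < r" "least_class r f T = card {x \<in> T. f x = i}" by auto
  define g where "g = f(m := i)"
  have g: "g \<in> cuts r {..<Suc m}"
    using assms(4) i unfolding g_def cuts_def lessThan_Suc by (auto simp: PiE_iff extensional_def)
  have fin: "finite A" "finite T"
    using assms(2,3) finite_all_edges[of "{..<m}"] by (auto intro: finite_subset)
  have "inj_on ?st T" by (auto simp: inj_on_def doubleton_eq_iff)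
  then have inj: "inj_on ?st {x \<in> T. f x \<noteq> i}" by (rule inj_on_subset) auto
  have sub: "{e \<in> A. \<exists>u\<in>e. \<exists>v\<in>e. f u \<noteq> f v} \<union> ?st ` {x \<in> T. f x \<noteq> i}
      \<subseteq> {e \<in> A \<union> ?st ` T. \<exists>u\<in>e. \<exists>v\<in>e. g u \<noteq> g v}"
  proof
    fix e assume "e \<in> {e \<in> A. \<exists>u\<in>e. \<exists>v\<in>e. f u \<noteq> f v} \<union> ?st ` {x \<in> T. f x \<noteq> i}"
    then show "e \<in> {e \<in> A \<union> ?st ` T. \<exists>u\<in>e. \<exists>v\<in>e. g u \<noteq> g v}"
    proof
      assume e: "e \<in> {e \<in> A. \<exists>u\<in>e. \<exists>v\<in>e. f u \<noteq> f v}"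
      then have "m \<notin> e" using assms(2) by (auto simp: all_edges_def)
      then have "g u = f u" if "u \<in> e" for u using that by (auto simp: g_def)
      then show ?thesis using e by auto
    next
      assume "e \<in> ?st ` {x \<in> T. f x \<noteq> i}"
      then obtain x where x: "e = {x, m}" "x \<in> T" "f x \<noteq> i" by auto
      then have "x \<noteq> m" using assms(3) by auto
      then show ?thesis using x by (auto simp: g_def)
    qed
  qed
  have disj: "{e \<in> A. \<exists>u\<in>e. \<exists>v\<in>e. f u \<noteq> f v} \<inter> ?st ` {x \<in> T. f x \<noteq> i} = {}"
    using assms(2) by (auto simp: all_edges_def)
  have "cut_size A f + card {x \<in> T. f x \<noteq> i}
      = card ({e \<in> A. \<exists>u\<in>e. \<exists>v\<in>e. f u \<noteq> f v} \<union> ?st ` {x \<in> T. f x \<noteq> i})"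
    unfolding cut_size_def using fin disj by (simp add: card_Un_disjoint card_image[OF inj])
  also have "\<dots> \<le> cut_size (A \<union> ?st ` T) g"
    unfolding cut_size_def using fin sub by (intro card_mono) auto
  also have "\<dots> \<le> maxcut r {..<Suc m} (A \<union> ?st ` T)"
    using g by (intro cut_size_le_maxcut) auto
  finally have "cut_size A f + card {x \<in> T. f x \<noteq> i} \<le> maxcut r {..<Suc m} (A \<union> ?st ` T)" .
  moreover have "card T = card {x \<in> T. f x = i} + card {x \<in> T. f x \<noteq> i}"
    using fin by (subst card_Un_disjoint[symmetric]) (auto intro!: arg_cong[of _ _ card])
  ultimately show ?thesis using i assms(5) by simp
qed

text \<open>
  The edges from vertex \<open>m\<close> to \<open>{..<m}\<close> are independent of the graph on \<open>{..<m}\<close>, so a maximum cut of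
  the latter is a fixed classification of the possible neighbours of \<open>m\<close>.
\<close>

lemma mean_maxcut_ge:
  fixes r :: nat
  assumes "r \<ge> 2" "0 \<le> p" "p \<le> 1"
  shows "bmean p (all_edges {..<n}) (\<lambda>E. real (maxcut r {..<n} E))
    \<ge> (1 - 1 / r) * p * (real n * (real n - 1) / 2) + (\<Sum>m<n. greedy_gain p r m)"
proof (induction n)
  case 0
  show ?case
    using bmean_mono[of p "all_edges {}" "\<lambda>_. 0" "\<lambda>E. real (maxcut r {} E)"] assms
    by (simp add: finite_all_edges)
next
  case (Suc m)
  let ?st = "\<lambda>u. {u, m}"
  let ?M = "\<lambda>A. real (maxcut r {..<m} A)"
  let ?c = "(1 - 1 / r) * p * m + greedy_gain p r m"
  have inj: "inj_on ?st {..<m}" by (auto simp: inj_on_def doubleton_eq_iff)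
  have "bmean p (all_edges {..<Suc m}) (\<lambda>E. real (maxcut r {..<Suc m} E))
      = bmean p (all_edges {..<m}) (\<lambda>A. bmean p {..<m}
          (\<lambda>T. real (maxcut r {..<Suc m} (A \<union> ?st ` T))))"
    unfolding all_edges_Suc(1) using all_edges_Suc(2)[of m] inj
    by (simp add: bmean_union bmean_image finite_all_edges)
  also have "\<dots> \<ge> bmean p (all_edges {..<m}) (\<lambda>A. ?M A + ?c)"
  proof (rule bmean_mono)
    fix A assume A: "A \<subseteq> all_edges {..<m}"
    obtain f where f: "f \<in> cuts r {..<m}" "cut_size A f = maxcut r {..<m} A"
      using assms max_cut_exists[of "{..<m}" r A] by auto
    have lc: "bmean p {..<m} (\<lambda>T. real (least_class r f T)) \<le> p * m / r - greedy_gain p r m"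
      using mean_least_class[of "{..<m}" f r p] f assms by (auto simp: cuts_def)
    have "?M A + ?c \<le> ?M A + p * m - bmean p {..<m} (\<lambda>T. real (least_class r f T))"
      using lc by (simp add: algebra_simps)
    also have "\<dots> = bmean p {..<m} (\<lambda>T. ?M A + real (card T) - real (least_class r f T))"
      by (simp add: bmean_diff bmean_add bmean_card)
    also have "\<dots> \<le> bmean p {..<m} (\<lambda>T. real (maxcut r {..<Suc m} (A \<union> ?st ` T)))"
      using assms(2,3)
    proof (rule bmean_mono)
      fix T :: "nat set" assume "T \<subseteq> {..<m}"
      from maxcut_add_vertex[OF _ A this f] assms(1)
      show "?M A + real (card T) - real (least_class r f T)
          \<le> real (maxcut r {..<Suc m} (A \<union> ?st ` T))" by simp
    qed
    finally show "?M A + ?c \<le> bmean p {..<m} (\<lambda>T. real (maxcut r {..<Suc m} (A \<union> ?st ` T)))" .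
  qed (use assms in auto)
  also have "bmean p (all_edges {..<m}) (\<lambda>A. ?M A + ?c) = bmean p (all_edges {..<m}) ?M + ?c"
    by (simp add: bmean_add finite_all_edges)
  finally show ?case using Suc by (simp add: field_simps)
qed

section \<open>Edges whose presence does not affect the maximum cut\<close>

text \<open>
  A pair of vertices is slack if adding or removing it as an edge leaves the size of a maximum cut
  unchanged. Whether \<open>e\<close> is slack does not depend on whether \<open>e\<close> is present.
\<close>

definition slack :: "nat \<Rightarrow> 'a set \<Rightarrow> 'a set set \<Rightarrow> 'a set \<Rightarrow> bool" where
  "slack r V E e \<longleftrightarrow> maxcut r V (insert e E) = maxcut r V (E - {e})"

lemma slack_Diff: "slack r V (E - {e}) e = slack r V E e"
  by (simp add: slack_def)

text \<open>The mean number of slack edges is exactly \<open>p\<close> times the mean number of slack pairs.\<close>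

lemma mean_slack_edges:
  assumes "finite V"
  shows "bmean p (all_edges V) (\<lambda>E. real (card {e \<in> E. slack r V E e}))
    = p * bmean p (all_edges V) (\<lambda>E. real (card {e \<in> all_edges V. slack r V E e}))"
proof -
  let ?S = "all_edges V"
  note fin = finite_all_edges[OF assms]
  have "bmean p ?S (\<lambda>E. real (card {e \<in> E. slack r V E e}))
      = bmean p ?S (\<lambda>E. \<Sum>e\<in>?S. of_bool (e \<in> E) * of_bool (slack r V (E - {e}) e))"
  proof (rule bmean_cong)
    fix E assume "E \<subseteq> ?S"
    then have "{e \<in> E. slack r V E e} = {e \<in> ?S. e \<in> E \<and> slack r V E e}" by auto
    then show "real (card {e \<in> E. slack r V E e})
        = (\<Sum>e\<in>?S. of_bool (e \<in> E) * of_bool (slack r V (E - {e}) e))"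
      using fin by (simp add: slack_Diff Int_def flip: of_bool_conj)
  qed
  also have "\<dots> = (\<Sum>e\<in>?S. p * bmean p ?S (\<lambda>E. of_bool (slack r V (E - {e}) e)))"
    unfolding bmean_sum using fin
    by (intro sum.cong bmean_independent[where F = "\<lambda>E. of_bool (slack r V E _)"]) auto
  also have "\<dots> = p * bmean p ?S (\<lambda>E. \<Sum>e\<in>?S. of_bool (slack r V E e))"
    unfolding bmean_sum sum_distrib_left slack_Diff ..
  finally show ?thesis using fin by (simp add: Int_def)
qed

lemma cut_size_insert_le: "finite E \<Longrightarrow> cut_size (insert e E) f \<le> Suc (cut_size E f)"
proof -
  assume "finite E"
  then have "card {d \<in> insert e E. \<exists>u\<in>d. \<exists>v\<in>d. f u \<noteq> f v}
      \<le> card (insert e {d \<in> E. \<exists>u\<in>d. \<exists>v\<in>d. f u \<noteq> f v})"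
    by (intro card_mono) auto
  also have "\<dots> \<le> Suc (card {d \<in> E. \<exists>u\<in>d. \<exists>v\<in>d. f u \<noteq> f v})"
    by (rule card_insert_le_m1[THEN order_trans]) (auto simp: card_insert_if)
  finally show ?thesis by (simp add: cut_size_def)
qed

lemma cut_size_mono: "finite E' \<Longrightarrow> E \<subseteq> E' \<Longrightarrow> cut_size E f \<le> cut_size E' f"
  unfolding cut_size_def by (intro card_mono) auto

lemma cut_size_unseparated:
  assumes "\<forall>u\<in>e. \<forall>v\<in>e. f u = f v"
  shows "cut_size (insert e E) f = cut_size E f" "cut_size (E - {e}) f = cut_size E f"
  unfolding cut_size_def using assms by (auto intro!: arg_cong[of _ _ card])

lemma maxcut_mono:
  assumes "finite V" "0 < r" "finite E'" "E \<subseteq> E'"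
  shows "maxcut r V E \<le> maxcut r V E'"
proof -
  obtain f where "f \<in> cuts r V" "cut_size E f = maxcut r V E"
    using assms(1,2) by (rule max_cut_exists)
  then show ?thesis
    using cut_size_mono[OF assms(3,4), of f] cut_size_le_maxcut[OF assms(1), of f r E'] by simp
qed

text \<open>
  Removing an edge that every maximum cut separates lowers the maximum, so such an edge is not
  slack.
\<close>

lemma slack_edge_unseparated:
  assumes "finite V" "0 < r" "finite E" "e \<in> E" "slack r V E e"
  obtains g where "g \<in> cuts r V" "cut_size E g = maxcut r V E" "\<forall>u\<in>e. \<forall>v\<in>e. g u = g v"
proof -
  obtain g where g: "g \<in> cuts r V" "cut_size (E - {e}) g = maxcut r V (E - {e})"
    using assms(1,2) by (rule max_cut_exists)
  have eq: "maxcut r V (E - {e}) = maxcut r V E"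
    using assms(4,5) by (simp add: slack_def insert_absorb)
  have "cut_size (E - {e}) g \<le> cut_size E g"
    using assms(3) by (intro cut_size_mono) auto
  moreover have "cut_size E g \<le> maxcut r V E"
    using assms(1) g(1) by (rule cut_size_le_maxcut)
  ultimately have size: "cut_size E g = maxcut r V E" "cut_size (E - {e}) g = cut_size E g"
    using g eq by auto
  have "\<forall>u\<in>e. \<forall>v\<in>e. g u = g v"
  proof (rule ccontr)
    let ?C = "{d \<in> E. \<exists>u\<in>d. \<exists>v\<in>d. g u \<noteq> g v}"
    assume "\<not> ?thesis"
    then have "e \<in> ?C" using assms(4) by auto
    moreover have "{d \<in> E - {e}. \<exists>u\<in>d. \<exists>v\<in>d. g u \<noteq> g v} = ?C - {e}" by auto
    ultimately have "cut_size (E - {e}) g < cut_size E g"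
      unfolding cut_size_def using assms(3) by (simp add: card_Diff1_less del: card_Diff_insert)
    then show False using size by simp
  qed
  then show ?thesis using that g size by blast
qed

lemma equivalent_imp_slack:
  assumes "finite V" "0 < r" "finite E" "(u, v) \<in> cut_equiv r V E"
  shows "slack r V E {u, v}"
proof -
  let ?e = "{u, v}"
  have same: "\<forall>a\<in>?e. \<forall>b\<in>?e. f a = f b" if "f \<in> cuts r V" "cut_size E f = maxcut r V E" for f
  proof -
    have "f \<in> max_cuts r V E" using that assms(1,2) by (simp add: max_cuts_iff)
    then show ?thesis using assms(4) by (auto simp: cut_equiv_def)
  qed
  obtain f where f: "f \<in> cuts r V" "cut_size E f = maxcut r V E"
    using assms(1,2) by (rule max_cut_exists)
  have "maxcut r V E \<le> maxcut r V (E - {?e})"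
    using cut_size_le_maxcut[OF assms(1) f(1), of "E - {?e}"] cut_size_unseparated[OF same[OF f]] f
    by simp
  moreover obtain h where h: "h \<in> cuts r V" "cut_size (insert ?e E) h = maxcut r V (insert ?e E)"
    using assms(1,2) by (rule max_cut_exists)
  have "maxcut r V (insert ?e E) \<le> maxcut r V E"
  proof (rule ccontr)
    assume less: "\<not> maxcut r V (insert ?e E) \<le> maxcut r V E"
    then have "maxcut r V E \<le> cut_size E h"
      using h cut_size_insert_le[OF assms(3), of ?e h] by simp
    then have "cut_size E h = maxcut r V E"
      using cut_size_le_maxcut[OF assms(1) h(1), of E] by simp
    then show False
      using cut_size_unseparated(1)[OF same[OF h(1)], of E] h less by simp
  qed
  moreover have "maxcut r V (E - {?e}) \<le> maxcut r V (insert ?e E)"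
    using assms by (intro maxcut_mono) auto
  ultimately show ?thesis by (simp add: slack_def)
qed

section \<open>Slack pairs and the core\<close>

lemma core_exterior_subset: "core_exterior r V E \<subseteq> V"
  by (auto simp: core_exterior_def)

lemma core_exterior_core:
  assumes "finite V" "is_core r V E K"
  shows "core_exterior r V E = V - \<Union>K"
proof -
  have "(THE K. is_core r V E K) = K"
    using assms(2) by (intro the_equality is_core_unique[OF assms(1)])
  then show ?thesis using assms by (auto simp: core_exterior_def)
qed

lemma core_component:
  assumes "is_core r V E K" "C \<in> K"
  shows "C \<subseteq> V" "C \<noteq> {}" "a \<in> C \<Longrightarrow> b \<in> C \<Longrightarrow> (a, b) \<in> cut_equiv r V E"
proof -
  have C: "C \<in> V // cut_equiv r V E"
    using assms by (auto simp: is_core_def cut_components_def)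
  show "C \<subseteq> V" using C equiv_cut_equiv[of V r E] in_quotient_imp_subset by blast
  show "C \<noteq> {}" using C equiv_cut_equiv[of V r E] in_quotient_imp_non_empty by blast
  show "a \<in> C \<Longrightarrow> b \<in> C \<Longrightarrow> (a, b) \<in> cut_equiv r V E"
    using C equiv_cut_equiv[of V r E] in_quotient_imp_in_rel by fastforce
qed

lemma core_disjoint:
  assumes "is_core r V E K" "C \<in> K" "D \<in> K" "C \<noteq> D"
  shows "C \<inter> D = {}"
  using assms quotient_disj[OF equiv_cut_equiv[of V r E], of C D]
  by (auto simp: is_core_def cut_components_def)

lemma real_choose_two: "real (k choose 2) = real k * (real k - 1) / 2"
  by (induction k) (simp_all add: numeral_2_eq_2 field_simps)

text \<open>
  Pairs inside a core component are slack. By convexity, their number is smallest when the core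
  components have equal sizes.
\<close>

lemma card_slack_ge:
  fixes r :: nat
  assumes "finite V" "0 < r" "E \<subseteq> all_edges V"
  defines "n \<equiv> real (card V)"
  shows "n\<^sup>2 / (2 * r) - n * real (x_core r V E) / r - n / 2
    \<le> real (card {e \<in> all_edges V. slack r V E e})"
proof (cases "\<exists>K. is_core r V E K")
  case False
  then have x: "real (x_core r V E) = n" by (simp add: x_core_def core_exterior_def n_def)
  have "n\<^sup>2 / (2 * r) \<le> n * n / r"
    using assms(2) by (simp add: power2_eq_square field_simps)
  moreover have "0 \<le> n" by (simp add: n_def)
  ultimately show ?thesis unfolding x by linarith
next
  case True
  then obtain K where K: "is_core r V E K" by auto
  have finE: "finite E" using assms finite_all_edges finite_subset by blast
  have finK: "finite K" "card K = r" using K by (auto simp: is_core_def)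
  have finC: "finite C" if "C \<in> K" for C
    using core_component(1)[OF K that] assms(1) finite_subset by blast
  define s where "s = (\<Sum>C\<in>K. real (card C))"
  have disjK: "disjnt C D" if "C \<in> K" "D \<in> K" "C \<noteq> D" for C D
    using core_disjoint[OF K that] by (simp add: disjnt_def)
  have s: "s = n - real (x_core r V E)"
  proof -
    have sub: "\<Union>K \<subseteq> V" using core_component(1)[OF K] by auto
    have "card (\<Union>K) = (\<Sum>C\<in>K. card C)"
      using disjK finC by (intro card_Union_disjoint) (auto simp: pairwise_def)
    moreover have "x_core r V E = card V - card (\<Union>K)"
      unfolding x_core_def core_exterior_core[OF assms(1) K]
      using sub assms(1) finite_subset by (intro card_Diff_subset) auto
    moreover have "card (\<Union>K) \<le> card V" using sub assms(1) by (intro card_mono)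
    ultimately show ?thesis by (simp add: s_def n_def of_nat_diff flip: of_nat_sum)
  qed
  have "(\<Union>C\<in>K. all_edges C) \<subseteq> {e \<in> all_edges V. slack r V E e}"
  proof
    fix e assume "e \<in> (\<Union>C\<in>K. all_edges C)"
    then obtain C where C: "C \<in> K" "e \<subseteq> C" "card e = 2" by (auto simp: all_edges_def)
    then obtain u v where uv: "e = {u, v}" by (auto simp: card_2_iff)
    then have "slack r V E e"
      using C core_component(3)[OF K C(1)] assms finE by (auto intro!: equivalent_imp_slack)
    then show "e \<in> {e \<in> all_edges V. slack r V E e}"
      using C core_component(1)[OF K C(1)] by (auto simp: all_edges_def)
  qed
  then have "card (\<Union>C\<in>K. all_edges C) \<le> card {e \<in> all_edges V. slack r V E e}"
    using assms(1) by (intro card_mono) (auto simp: finite_all_edges)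
  moreover have "card (\<Union>C\<in>K. all_edges C) = (\<Sum>C\<in>K. card (all_edges C))"
  proof (rule card_UN_disjoint)
    show "\<forall>C\<in>K. \<forall>D\<in>K. C \<noteq> D \<longrightarrow> all_edges C \<inter> all_edges D = {}"
    proof (intro ballI impI)
      fix C D assume CD: "C \<in> K" "D \<in> K" "C \<noteq> D"
      have "False" if "e \<in> all_edges C" "e \<in> all_edges D" for e
      proof -
        have "e \<subseteq> C \<inter> D" "card e = 2" using that by (auto simp: all_edges_def)
        then show False using core_disjoint[OF K CD] by auto
      qed
      then show "all_edges C \<inter> all_edges D = {}" by auto
    qed
  qed (use finK finC finite_all_edges in auto)
  moreover have "real (card (all_edges C)) = real (card C) * (real (card C) - 1) / 2" if "C \<in> K" for C
    using n_subsets[OF finC[OF that], of 2] by (simp add: all_edges_def real_choose_two)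
  ultimately have "(\<Sum>C\<in>K. real (card C) * (real (card C) - 1) / 2)
      \<le> real (card {e \<in> all_edges V. slack r V E e})"
    by (simp flip: of_nat_le_iff[where 'a = real])
  moreover have "(\<Sum>C\<in>K. real (card C) * (real (card C) - 1) / 2)
      = (\<Sum>C\<in>K. (real (card C))\<^sup>2) / 2 - s / 2"
    by (simp add: s_def sum_divide_distrib power2_eq_square algebra_simps
        diff_divide_distrib flip: sum_subtractf)
  moreover have "s\<^sup>2 / r \<le> (\<Sum>C\<in>K. (real (card C))\<^sup>2)"
    using sum_squared_le_sum_of_squares[of "\<lambda>C. real (card C)" K] finK assms(2)
    by (simp add: s_def field_simps)
  moreover have "n\<^sup>2 / (2 * r) - n * real (x_core r V E) / r \<le> s\<^sup>2 / r / 2"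
  proof -
    have "n\<^sup>2 - 2 * n * real (x_core r V E) \<le> s\<^sup>2"
      unfolding s by (simp add: power2_diff)
    then have "(n\<^sup>2 - 2 * n * real (x_core r V E)) / (2 * r) \<le> s\<^sup>2 / (2 * r)"
      by (intro divide_right_mono) auto
    then show ?thesis using assms(2) by (simp add: diff_divide_distrib)
  qed
  moreover have "s \<le> n" using s by simp
  moreover have "l - n / 2 \<le> b" if "a \<le> b" "a = q / 2 - s / 2" "t \<le> q" "l \<le> t / 2" "s \<le> n"
    for a b l q t :: real
    using that by linarith
  ultimately show ?thesis by blast
qed

text \<open>
  If a maximum cut puts two core components into the same part, some part contains no core
  component; since moving \<open>C\<close> there does not enlarge the cut, there are not many edges between
  \<open>C\<close> and \<open>D\<close>.
\<close>

lemma card_edges_between_merged_components: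
  assumes "finite V" "0 < r" "E \<subseteq> all_edges V" "is_core r V E K" "C \<in> K" "D \<in> K" "C \<noteq> D"
    and g: "g \<in> cuts r V" "cut_size E g = maxcut r V E" "u \<in> C" "v \<in> D" "g u = g v"
  shows "card {e \<in> E. e \<inter> C \<noteq> {} \<and> e \<inter> D \<noteq> {}}
    \<le> card {e \<in> E. e \<inter> core_exterior r V E \<noteq> {}}"
proof -
  let ?X = "core_exterior r V E"
  have X: "?X = V - \<Union>K" using assms by (intro core_exterior_core)
  have finE: "finite E" using assms finite_all_edges finite_subset by blast
  have const: "g a = g b" if "B \<in> K" "a \<in> B" "b \<in> B" for a b B
    using core_component(3)[OF assms(4) that] g assms(1,2) by (auto simp: cut_equiv_def max_cuts_iff)
  define rep where "rep = (\<lambda>B. SOME a. a \<in> (B :: 'a set))"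
  have rep: "rep B \<in> B" if "B \<in> K" for B
    using core_component(2)[OF assms(4) that] by (auto simp: rep_def some_in_eq)
  have "g (rep C) = g (rep D)"
    using const[OF assms(5) g(3) rep[OF assms(5)]] const[OF assms(6) g(4) rep[OF assms(6)]] g(5)
    by simp
  then have "\<not> inj_on (\<lambda>B. g (rep B)) K"
    using assms(5-7) by (auto simp: inj_on_def)
  moreover have finK: "finite K" "card K = r" using assms(4) by (auto simp: is_core_def)
  ultimately have "card ((\<lambda>B. g (rep B)) ` K) < card {..<r}"
    using card_image_le[OF finK(1), of "\<lambda>B. g (rep B)"] eq_card_imp_inj_on[OF finK(1)]
    by (metis card_lessThan le_neq_implies_less)
  then obtain i where i: "i < r" "i \<notin> (\<lambda>B. g (rep B)) ` K"
    using card_mono[of "(\<lambda>B. g (rep B)) ` K" "{..<r}"] finK(1) by fastforce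
  have empty: "a \<in> ?X" if a: "a \<in> V" "g a = i" for a
  proof (rule ccontr)
    assume "a \<notin> ?X"
    then obtain B where "B \<in> K" "a \<in> B" using a X by auto
    then show False using const[of B a "rep B"] rep i a by auto
  qed
  \<comment> \<open>Moving \<open>C\<close> to part \<open>i\<close> separates it from \<open>D\<close> and can only join it to vertices of the exterior.\<close>
  define h where "h = (\<lambda>x. if x \<in> C then i else g x)"
  have h: "h \<in> cuts r V"
    using g(1) i(1) core_component(1)[OF assms(4,5)]
    by (auto simp: h_def cuts_def PiE_iff extensional_def)
  let ?sep = "\<lambda>f. {e \<in> E. \<exists>u\<in>e. \<exists>v\<in>e. f u \<noteq> f v}"
  let ?CD = "{e \<in> E. e \<inter> C \<noteq> {} \<and> e \<inter> D \<noteq> {}}"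
  let ?EX = "{e \<in> E. e \<inter> ?X \<noteq> {}}"
  have CD: "C \<inter> D = {}" using assms by (intro core_disjoint)
  have gCD: "g a = g b" if "a \<in> C" "b \<in> D" for a b
    using const[OF assms(5) that(1) g(3)] const[OF assms(6) g(4) that(2)] g(5) by simp
  have edge: "\<exists>a\<in>V. \<exists>b\<in>V. a \<noteq> b \<and> e = {a, b}" if "e \<in> E" for e
    using that assms(3) by (force simp: all_edges_def card_2_iff)
  have "?sep g \<union> ?CD \<subseteq> ?sep h \<union> ?EX"
  proof
    fix e assume e: "e \<in> ?sep g \<union> ?CD"
    then obtain a b where ab: "a \<in> V" "b \<in> V" "e = {a, b}" "e \<in> E" using edge by blast
    show "e \<in> ?sep h \<union> ?EX"
    proof (rule ccontr)
      assume "e \<notin> ?sep h \<union> ?EX"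
      then have no: "h a = h b" "a \<notin> ?X" "b \<notin> ?X" using ab by auto
      then have "g a \<noteq> i" "g b \<noteq> i" using empty ab by auto
      then have "a \<in> C \<longleftrightarrow> b \<in> C" using no by (auto simp: h_def split: if_splits)
      moreover have "a \<in> C \<Longrightarrow> b \<in> C \<Longrightarrow> e \<in> ?sep g \<union> ?CD \<Longrightarrow> False"
        using const[OF assms(5), of a b] CD ab by auto
      moreover have "a \<notin> C \<Longrightarrow> b \<notin> C \<Longrightarrow> g a = g b"
        using no by (simp add: h_def)
      ultimately show False using e ab by auto
    qed
  qed
  moreover have "?sep g \<inter> ?CD = {}"
  proof -
    have "g a = g b" if "{a, b} \<in> ?CD" for a b
      using that CD gCD by (auto dest: gCD)
    then show ?thesis using edge by fastforce
  qed
  then have "card (?sep g \<union> ?CD) = card (?sep g) + card ?CD"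
    using finE by (intro card_Un_disjoint) auto
  moreover have "finite (?sep h \<union> ?EX)" using finE by simp
  ultimately have "card (?sep g) + card ?CD \<le> card (?sep h \<union> ?EX)"
    by (metis (no_types, lifting) card_mono)
  also have "\<dots> \<le> card (?sep h) + card ?EX" by (rule card_Un_le)
  also have "card (?sep h) \<le> card (?sep g)"
    using cut_size_le_maxcut[OF assms(1) h, of E] g(2) by (simp add: cut_size_def)
  finally show ?thesis by simp
qed

text \<open>
  A slack edge that is separated by a fixed maximum cut lies inside a part of another maximum cut,
  so it either touches the exterior of the core or joins two core components that some maximum cut
  merges.
\<close>

lemma card_slack_edges_le:
  assumes "finite V" "0 < r" "E \<subseteq> all_edges V"
  shows "card {e \<in> E. slack r V E e} + maxcut r V E
    \<le> card E + (1 + r\<^sup>2) * card {e \<in> E. e \<inter> core_exterior r V E \<noteq> {}}"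
proof -
  let ?X = "core_exterior r V E"
  let ?EX = "{e \<in> E. e \<inter> ?X \<noteq> {}}"
  have finE: "finite E" using assms finite_all_edges finite_subset by blast
  have edge: "\<exists>a\<in>V. \<exists>b\<in>V. a \<noteq> b \<and> e = {a, b}" if "e \<in> E" for e
    using that assms(3) by (force simp: all_edges_def card_2_iff)
  obtain f where f: "f \<in> cuts r V" "cut_size E f = maxcut r V E"
    using assms(1,2) by (rule max_cut_exists)
  let ?sep = "{e \<in> E. \<exists>u\<in>e. \<exists>v\<in>e. f u \<noteq> f v}"
  let ?T = "{e \<in> ?sep. slack r V E e}"
  have T: "card ?T \<le> (1 + r\<^sup>2) * card ?EX"
  proof (cases "\<exists>K. is_core r V E K")
    case False
    then have "?X = V" by (simp add: core_exterior_def)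
    then have "?T \<subseteq> ?EX" using edge by fastforce
    then have "card ?T \<le> card ?EX" using finE by (intro card_mono) auto
    then show ?thesis by simp
  next
    case True
    then obtain K where K: "is_core r V E K" by auto
    have finK: "finite K" "card K = r" using K by (auto simp: is_core_def)
    have X: "?X = V - \<Union>K" using core_exterior_core[OF assms(1) K] .
    define CD where "CD = (\<lambda>(C, D). {e \<in> E. e \<inter> C \<noteq> {} \<and> e \<inter> D \<noteq> {}})"
    define M where "M = {P \<in> K \<times> K. card (CD P) \<le> card ?EX}"
    have "?T \<subseteq> ?EX \<union> (\<Union>P\<in>M. CD P)"
    proof
      fix e assume e: "e \<in> ?T"
      then obtain a b where ab: "a \<in> V" "b \<in> V" "e = {a, b}" "e \<in> E" "f a \<noteq> f b"
        using edge[of e] by auto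
      show "e \<in> ?EX \<union> (\<Union>P\<in>M. CD P)"
      proof (cases "e \<in> ?EX")
        case False
        then obtain C D where CD: "C \<in> K" "a \<in> C" "D \<in> K" "b \<in> D" using ab X by auto
        have CD_ne: "C \<noteq> D"
          using core_component(3)[OF K CD(1), of a b] CD f ab(5) assms(1,2)
          by (auto simp: cut_equiv_def max_cuts_iff)
        have "slack r V E e" using e by simp
        then obtain g where g: "g \<in> cuts r V" "cut_size E g = maxcut r V E"
            "\<forall>u\<in>e. \<forall>v\<in>e. g u = g v"
          by (rule slack_edge_unseparated[OF assms(1,2) finE ab(4)])
        have "card (CD (C, D)) \<le> card ?EX"
          unfolding CD_def prod.case using ab(3) g(3)
          by (intro card_edges_between_merged_components[OF assms K CD(1,3) CD_ne g(1,2) CD(2,4)]) blast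
        then have "(C, D) \<in> M" using CD by (simp add: M_def)
        moreover have "e \<in> CD (C, D)" using CD ab by (auto simp: CD_def)
        ultimately show ?thesis by blast
      qed auto
    qed
    moreover have finM: "finite M" using finK by (simp add: M_def)
    moreover have "finite (CD P)" for P using finE by (cases P) (simp add: CD_def)
    ultimately have "card ?T \<le> card (?EX \<union> (\<Union>P\<in>M. CD P))"
      using finE by (intro card_mono) auto
    also have "\<dots> \<le> card ?EX + (\<Sum>P\<in>M. card (CD P))"
      using card_UN_le[OF finM, of CD] card_Un_le[of ?EX "\<Union>P\<in>M. CD P"] by linarith
    also have "(\<Sum>P\<in>M. card (CD P)) \<le> card M * card ?EX"
      using sum_bounded_above[of M "\<lambda>P. card (CD P)" "card ?EX"] by (simp add: M_def)
    also have "card M \<le> card (K \<times> K)"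
      using finK by (intro card_mono) (auto simp: M_def)
    finally show ?thesis using finK by (simp add: card_cartesian_product power2_eq_square)
  qed
  have "card {e \<in> E. slack r V E e} \<le> card ((E - ?sep) \<union> ?T)"
    using finE by (intro card_mono) auto
  also have "\<dots> \<le> card (E - ?sep) + card ?T" by (rule card_Un_le)
  also have "card (E - ?sep) = card E - card ?sep"
    using finE by (intro card_Diff_subset) auto
  finally have "card {e \<in> E. slack r V E e} \<le> card E - card ?sep + card ?T" .
  moreover have "card ?sep \<le> card E" using finE by (intro card_mono) auto
  moreover have "card ?sep = maxcut r V E" using f(2) by (simp add: cut_size_def)
  ultimately show ?thesis using T by linarith
qed

section \<open>The expected size of the exterior\<close>

text \<open>
  A degree exceeds \<open>2 p |V|\<close> only if it deviates by at least \<open>p |V|\<close> from its mean, and the excess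
  is then paid for by the square of the deviation.
\<close>

lemma card_edges_touching_le:
  assumes "finite V" "E \<subseteq> all_edges V" "X \<subseteq> V" "0 < p"
  defines "n \<equiv> real (card V)"
  shows "real (card {e \<in> E. e \<inter> X \<noteq> {}}) \<le> 2 * p * n * real (card X)
    + (\<Sum>v\<in>V. 1 / (p * n) * (centred (\<lambda>e. of_bool (v \<in> e)) p (all_edges V) E)\<^sup>2)"
proof -
  let ?c = "\<lambda>v. centred (\<lambda>e. of_bool (v \<in> e)) p (all_edges V) E"
  note finS = finite_all_edges[OF assms(1)]
  have finE: "finite E" using assms(2) finS by (rule finite_subset)
  have finX: "finite X" using assms(3,1) by (rule finite_subset)
  have deg: "real (card {e \<in> E. v \<in> e}) \<le> 2 * p * n + 1 / (p * n) * (?c v)\<^sup>2" if "v \<in> V" for v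
  proof -
    have "0 < card V" using assms(1) that by (auto simp: card_gt_0_iff)
    then have n: "0 < p * n" using assms(4) by (simp add: n_def)
    have "?c v = (\<Sum>e\<in>all_edges V. of_bool (v \<in> e \<and> e \<in> E)) - p * (\<Sum>e\<in>all_edges V. of_bool (v \<in> e))"
      by (simp only: centred_def right_diff_distrib sum_subtractf sum_distrib_left of_bool_conj
          mult.commute[of _ p])
    also have "\<dots> = real (card {e \<in> E. v \<in> e}) - p * real (card {e \<in> all_edges V. v \<in> e})"
    proof -
      have "all_edges V \<inter> {e. v \<in> e \<and> e \<in> E} = {e \<in> E. v \<in> e}" using assms(2) by auto
      moreover have "all_edges V \<inter> {e. v \<in> e} = {e \<in> all_edges V. v \<in> e}" by auto
      ultimately show ?thesis using finS by simp
    qed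
    finally have c: "?c v = real (card {e \<in> E. v \<in> e}) - p * real (card {e \<in> all_edges V. v \<in> e})" .
    have "{e \<in> all_edges V. v \<in> e} \<subseteq> (\<lambda>u. {u, v}) ` V"
      by (auto simp: all_edges_def card_2_iff)
    then have "card {e \<in> all_edges V. v \<in> e} \<le> card V"
      using assms(1) by (meson card_image_le card_mono finite_imageI le_trans)
    then have "p * real (card {e \<in> all_edges V. v \<in> e}) \<le> p * n"
      using assms(4) by (simp add: n_def)
    then have le: "real (card {e \<in> E. v \<in> e}) - p * n \<le> ?c v" using c by simp
    show ?thesis
    proof (cases "real (card {e \<in> E. v \<in> e}) \<le> 2 * p * n")
      case True
      then show ?thesis using n by (intro add_increasing2) auto
    next
      case False
      then have "p * n \<le> ?c v" using le by simp
      then have "?c v * (p * n) \<le> (?c v)\<^sup>2" using n by (simp add: power2_eq_square)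
      then have "?c v \<le> 1 / (p * n) * (?c v)\<^sup>2" using n by (simp add: field_simps)
      then show ?thesis using le n by linarith
    qed
  qed
  have "card {e \<in> E. e \<inter> X \<noteq> {}} \<le> card (\<Union>v\<in>X. {e \<in> E. v \<in> e})"
    using finE finX by (intro card_mono) auto
  also have "\<dots> \<le> (\<Sum>v\<in>X. card {e \<in> E. v \<in> e})" using finX by (rule card_UN_le)
  finally have "real (card {e \<in> E. e \<inter> X \<noteq> {}}) \<le> (\<Sum>v\<in>X. real (card {e \<in> E. v \<in> e}))"
    by (simp flip: of_nat_sum)
  also have "\<dots> \<le> (\<Sum>v\<in>X. 2 * p * n + 1 / (p * n) * (?c v)\<^sup>2)"
    using deg assms(3) by (intro sum_mono) auto
  also have "\<dots> = 2 * p * n * real (card X) + (\<Sum>v\<in>X. 1 / (p * n) * (?c v)\<^sup>2)"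
    by (simp add: sum.distrib)
  also have "(\<Sum>v\<in>X. 1 / (p * n) * (?c v)\<^sup>2) \<le> (\<Sum>v\<in>V. 1 / (p * n) * (?c v)\<^sup>2)"
    using assms by (intro sum_mono2) (auto simp: n_def)
  finally show ?thesis by simp
qed

lemma mean_card_edges_touching_exterior:
  assumes "finite V" "0 < p" "p \<le> 1"
  shows "bmean p (all_edges V) (\<lambda>E. real (card {e \<in> E. e \<inter> core_exterior r V E \<noteq> {}}))
    \<le> 2 * p * real (card V) * bmean p (all_edges V) (\<lambda>E. real (x_core r V E)) + real (card V)"
proof -
  let ?S = "all_edges V" and ?n = "real (card V)"
  let ?c = "\<lambda>v. centred (\<lambda>e. of_bool (v \<in> e)) p (all_edges V)"
  have finS: "finite ?S" using assms(1) by (rule finite_all_edges)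
  have second: "1 / (p * ?n) * bmean p ?S (\<lambda>E. (?c v E)\<^sup>2) \<le> 1" if "v \<in> V" for v
  proof -
    have "0 < card V" using assms(1) that by (auto simp: card_gt_0_iff)
    then have n: "0 < p * ?n" using assms(2) by simp
    have "?S \<inter> {e. v \<in> e} \<subseteq> (\<lambda>u. {u, v}) ` V"
      by (auto simp: all_edges_def card_2_iff)
    then have "card (?S \<inter> {e. v \<in> e}) \<le> card V"
      using assms(1) by (meson card_image_le card_mono finite_imageI le_trans)
    moreover have "(\<Sum>e\<in>?S. (of_bool (v \<in> e))\<^sup>2) = real (card (?S \<inter> {e. v \<in> e}))"
      using finS by (simp add: power2_eq_square flip: of_bool_conj)
    ultimately have "bmean p ?S (\<lambda>E. (?c v E)\<^sup>2) \<le> p * (1 - p) * ?n"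
      unfolding second_moment_centred[OF finS] using assms by (intro mult_left_mono) auto
    also have "\<dots> \<le> p * 1 * ?n"
      using assms by (intro mult_right_mono mult_left_mono) auto
    finally show ?thesis using n by (simp add: field_simps)
  qed
  have "bmean p ?S (\<lambda>E. real (card {e \<in> E. e \<inter> core_exterior r V E \<noteq> {}}))
      \<le> bmean p ?S (\<lambda>E. 2 * p * ?n * real (x_core r V E) + (\<Sum>v\<in>V. 1 / (p * ?n) * (?c v E)\<^sup>2))"
    unfolding x_core_def using assms
    by (intro bmean_mono card_edges_touching_le core_exterior_subset) auto
  also have "\<dots> = 2 * p * ?n * bmean p ?S (\<lambda>E. real (x_core r V E))
      + (\<Sum>v\<in>V. 1 / (p * ?n) * bmean p ?S (\<lambda>E. (?c v E)\<^sup>2))"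
    unfolding bmean_add bmean_sum bmean_cmult ..
  also have "(\<Sum>v\<in>V. 1 / (p * ?n) * bmean p ?S (\<lambda>E. (?c v E)\<^sup>2)) \<le> (\<Sum>v\<in>V. 1)"
    using second by (intro sum_mono)
  finally show ?thesis by simp
qed

lemma card_all_edges: "real (card (all_edges {..<n :: nat})) = real n * (real n - 1) / 2"
  using n_subsets[of "{..<n}" 2] by (simp add: all_edges_def real_choose_two)

text \<open>
  The identity for slack edges, with the lower bound for slack pairs and the upper bound for slack
  edges inserted. The terms of order \<open>p n\<^sup>2 / (2 r)\<close> cancel.
\<close>

lemma sum_greedy_gain_le:
  fixes r n :: nat
  assumes "r \<ge> 2" "0 < p" "p \<le> 1"
  defines "x \<equiv> bmean p (all_edges {..<n}) (\<lambda>E. real (x_core r {..<n} E))"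
  shows "(\<Sum>m<n. greedy_gain p r m)
    \<le> (3 + 2 * (real r)\<^sup>2) * (p * real n * x) + (2 + (real r)\<^sup>2) * real n"
proof -
  let ?S = "all_edges {..<n}" and ?V = "{..<n}" and ?n = "real n"
  let ?s = "\<lambda>E. {e \<in> E. slack r ?V E e}"
  let ?t = "\<lambda>E. {e \<in> E. e \<inter> core_exterior r ?V E \<noteq> {}}"
  have r: "real r \<ge> 2" using assms(1) by simp
  have finS: "finite ?S" by (simp add: finite_all_edges)
  have x0: "0 \<le> x"
    using bmean_mono[of p ?S "\<lambda>_. 0" "\<lambda>E. real (x_core r ?V E)"] assms finS by (simp add: x_def)
  have "p * (?n\<^sup>2 / (2 * r) - ?n / r * x - ?n / 2)
      = p * bmean p ?S (\<lambda>E. ?n\<^sup>2 / (2 * r) - ?n / r * real (x_core r ?V E) - ?n / 2)"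
    unfolding bmean_diff bmean_cmult x_def using finS by simp
  also have "\<dots> \<le> p * bmean p ?S (\<lambda>E. real (card {e \<in> ?S. slack r ?V E e}))"
  proof (intro mult_left_mono bmean_mono)
    fix E assume "E \<subseteq> ?S"
    then show "?n\<^sup>2 / (2 * r) - ?n / r * real (x_core r ?V E) - ?n / 2
        \<le> real (card {e \<in> ?S. slack r ?V E e})"
      using card_slack_ge[of ?V r E] assms(1) by simp
  qed (use assms in auto)
  also have "\<dots> = bmean p ?S (\<lambda>E. real (card (?s E)))"
    by (simp add: mean_slack_edges)
  also have "\<dots> \<le> bmean p ?S
      (\<lambda>E. real (card E) - real (maxcut r ?V E) + (1 + (real r)\<^sup>2) * real (card (?t E)))"
  proof (intro bmean_mono)
    fix E assume "E \<subseteq> ?S"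
    then have "card (?s E) + maxcut r ?V E \<le> card E + (1 + r\<^sup>2) * card (?t E)"
      using assms(1) by (intro card_slack_edges_le) auto
    then have "real (card (?s E) + maxcut r ?V E) \<le> real (card E + (1 + r\<^sup>2) * card (?t E))"
      by (simp only: of_nat_le_iff)
    then show "real (card (?s E))
        \<le> real (card E) - real (maxcut r ?V E) + (1 + (real r)\<^sup>2) * real (card (?t E))"
      by (simp add: algebra_simps)
  qed (use assms in auto)
  also have "\<dots> = p * (?n * (?n - 1) / 2) - bmean p ?S (\<lambda>E. real (maxcut r ?V E))
      + (1 + (real r)\<^sup>2) * bmean p ?S (\<lambda>E. real (card (?t E)))"
    unfolding bmean_add bmean_diff bmean_cmult bmean_card[OF finS] card_all_edges ..
  also have "\<dots> \<le> p * (?n * (?n - 1) / 2)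
      - ((1 - 1 / r) * p * (?n * (?n - 1) / 2) + (\<Sum>m<n. greedy_gain p r m))
      + (1 + (real r)\<^sup>2) * (2 * p * ?n * x + ?n)"
    using mean_maxcut_ge[of r p n] mean_card_edges_touching_exterior[of ?V p r] assms
    by (intro add_mono diff_left_mono mult_left_mono) (auto simp: x_def)
  finally have "p * (?n\<^sup>2 / (2 * r) - ?n / r * x - ?n / 2) \<le> \<dots>" .
  moreover have "(1 - 1 / r) * p * (?n * (?n - 1) / 2)
      = p * (?n * (?n - 1) / 2) - 1 / r * p * (?n * (?n - 1) / 2)"
    by (simp only: left_diff_distrib mult_1)
  moreover have "g \<le> b - l + z" if "l \<le> a - (h + g) + z" "h = a - b" for a b g h l z :: real
    using that by linarith
  ultimately have "(\<Sum>m<n. greedy_gain p r m)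
      \<le> 1 / r * p * (?n * (?n - 1) / 2) - p * (?n\<^sup>2 / (2 * r) - ?n / r * x - ?n / 2)
        + (1 + (real r)\<^sup>2) * (2 * p * ?n * x + ?n)"
    by blast
  also have "\<dots> = 1 / r * (p * ?n * x) + p * ?n / 2 - p * ?n / (2 * r)
        + (1 + (real r)\<^sup>2) * (2 * p * ?n * x + ?n)"
    using r by (simp add: field_simps power2_eq_square)
  also have "\<dots> \<le> 1 * (p * ?n * x) + ?n + (1 + (real r)\<^sup>2) * (2 * p * ?n * x + ?n)"
  proof -
    have "1 / r * (p * ?n * x) \<le> 1 * (p * ?n * x)"
      using r x0 assms by (intro mult_right_mono) auto
    moreover have "p * ?n \<le> ?n" using assms by (simp add: mult_left_le_one_le)
    moreover have "0 \<le> p * ?n / (2 * r)" "0 \<le> p * ?n" using assms by auto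
    ultimately show ?thesis by linarith
  qed
  finally show ?thesis by (simp add: algebra_simps)
qed

text \<open>The vertices in the second half each contribute a gain of order \<open>sqrt (n p)\<close>.\<close>

lemma sum_greedy_gain_ge:
  fixes r n :: nat
  assumes "r \<ge> 2" "0 < d" "0 \<le> p" "p \<le> 1 - d" "n \<ge> 2" "4 * real r / d \<le> real n * p"
  shows "real n / 2 * (3 / (32 * real r) * sqrt (d / (4 * real r)) * sqrt (real n * p))
    \<le> (\<Sum>m<n. greedy_gain p r m)"
proof -
  let ?b = "3 / (32 * real r) * sqrt (d / (4 * real r)) * sqrt (real n * p)"
  have r: "real r \<ge> 2" using assms(1) by simp
  have b0: "0 \<le> ?b" using assms by simp
  have nonneg: "0 \<le> greedy_gain p r m" for m
    using assms unfolding greedy_gain_def by (auto intro!: mult_nonneg_nonneg)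
  have big: "?b \<le> greedy_gain p r m" if m: "m \<in> {n div 2..<n}" for m
  proof -
    have "real n / 4 \<le> real m" using m assms(5) by simp linarith
    then have "p * d * (real n / 4) \<le> p * (1 - p) * real m"
      using assms by (intro mult_mono) auto
    then have "p * d * (real n / 4) / r \<le> p * (1 - p) * real m / r"
      by (intro divide_right_mono) auto
    moreover have "p * d * (real n / 4) / r = d / (4 * r) * (real n * p)" by simp
    ultimately have v: "d / (4 * r) * (real n * p) \<le> p * (1 - p) * real m / r" by (simp only:)
    have "1 \<le> d / (4 * r) * (real n * p)"
      using assms(2,6) r by (simp add: field_simps)
    then have gain: "greedy_gain p r m = 3 / (32 * real r) * sqrt (p * (1 - p) * real m / r)"
      using v by (auto simp: greedy_gain_def)
    have root: "sqrt (d / (4 * r) * (real n * p)) \<le> sqrt (p * (1 - p) * real m / r)"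
      using v by (rule real_sqrt_le_mono)
    have b: "?b = 3 / (32 * real r) * sqrt (d / (4 * r) * (real n * p))"
      by (simp only: real_sqrt_mult mult.assoc of_nat_mult of_nat_numeral)
    show ?thesis unfolding b gain using root by (rule mult_left_mono) simp
  qed
  have "real n / 2 \<le> real (n - n div 2)" by linarith
  then have "real n / 2 * ?b \<le> real (n - n div 2) * ?b" using b0 by (rule mult_right_mono)
  also have "\<dots> = (\<Sum>m\<in>{n div 2..<n}. ?b)" by simp
  also have "\<dots> \<le> (\<Sum>m\<in>{n div 2..<n}. greedy_gain p r m)" using big by (intro sum_mono)
  also have "\<dots> \<le> (\<Sum>m<n. greedy_gain p r m)" using nonneg by (intro sum_mono2) auto
  finally show ?thesis .
qed

theorem proposition2p16:
  fixes r :: nat and \<delta> :: real and p :: "nat \<Rightarrow> real"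
  assumes "r \<ge> 2" and "\<delta> > 0"
    and "\<And>n. 0 \<le> p n \<and> p n \<le> 1"
    and "(\<lambda>n. 1 / real n) \<in> o(p)"
    and "\<forall>\<^sub>F n in sequentially. p n \<le> 1 - \<delta>"
  shows "(\<lambda>n. measure_pmf.expectation (binomial_graph n (p n)) (\<lambda>E. real (x_core r {..<n} E)))
           \<in> \<Omega>(\<lambda>n. sqrt (real n / p n))"
proof -
  define c where "c = 3 / (32 * real r) * sqrt (\<delta> / (4 * real r))"
  define k where "k = 3 + 2 * (real r)\<^sup>2"
  \<comment> \<open>Once \<open>n p \<ge> Q\<close>, the greedy gain is in force and outweighs the error terms of order \<open>n\<close>.\<close>
  define Q where "Q = max (4 * real r / \<delta>) ((4 * (2 + (real r)\<^sup>2) / c)\<^sup>2)"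
  have r: "real r \<ge> 2" using assms(1) by simp
  have c: "c > 0" using r assms(2) by (simp add: c_def)
  have k: "k > 0" by (simp add: k_def add_pos_nonneg)
  have Q: "Q > 0" using r assms(2) by (simp add: Q_def less_max_iff_disj)
  have "\<forall>\<^sub>F n in sequentially. norm (1 / real n) \<le> 1 / Q * norm (p n)"
    using assms(4) Q by (intro landau_o.smallD) auto
  moreover have "\<forall>\<^sub>F n in sequentially. n \<ge> (2 :: nat)" by (rule eventually_ge_at_top)
  ultimately have "\<forall>\<^sub>F n in sequentially. c / (4 * k) * norm (sqrt (real n / p n))
      \<le> norm (measure_pmf.expectation (binomial_graph n (p n)) (\<lambda>E. real (x_core r {..<n} E)))"
    using assms(5)
  proof eventually_elim
    case (elim n)
    define q where "q = sqrt (real n * p n)"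
    define x where "x = bmean (p n) (all_edges {..<n}) (\<lambda>E. real (x_core r {..<n} E))"
    have n: "real n > 0" using elim by simp
    have p01: "0 \<le> p n" "p n \<le> 1" using assms(3) by auto
    have np: "Q \<le> real n * p n" using elim(1) n Q p01 by (simp add: field_simps)
    then have pos: "p n > 0" using Q n p01 by (metis less_eq_real_def mult_zero_right not_le)
    have q: "q > 0" "q\<^sup>2 = real n * p n" using n pos by (auto simp: q_def)
    have "(4 * (2 + (real r)\<^sup>2) / c)\<^sup>2 \<le> q\<^sup>2" using np q(2) by (simp add: Q_def)
    then have "4 * (2 + (real r)\<^sup>2) / c \<le> q" by (rule power2_le_imp_le) (use q(1) in simp)
    then have err: "(2 + (real r)\<^sup>2) \<le> c * q / 4" using c by (simp add: field_simps)
    have "real n / 2 * (c * q) \<le> (\<Sum>m<n. greedy_gain (p n) r m)"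
      unfolding c_def q_def using assms(1,2) p01 elim np
      by (intro sum_greedy_gain_ge) (auto simp: Q_def)
    also have "\<dots> \<le> k * (p n * real n * x) + (2 + (real r)\<^sup>2) * real n"
      unfolding k_def x_def using assms(1) pos p01 by (intro sum_greedy_gain_le)
    also have "\<dots> \<le> k * (p n * real n * x) + c * q / 4 * real n"
      using err n by (intro add_left_mono mult_right_mono) auto
    finally have "c * q / 4 * real n \<le> k * (q\<^sup>2 * x)" using q(2) by (simp add: algebra_simps)
    then have "q * (c / 4 * real n) \<le> q * (k * q * x)" by (simp add: power2_eq_square algebra_simps)
    then have "c / 4 * real n \<le> k * q * x" using q(1) by (simp only: mult_le_cancel_left_pos)
    then have "c / (4 * k) * (real n / q) \<le> x" using q(1) k by (simp add: field_simps)
    moreover have "real n / q = sqrt (real n / p n)"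
      using n pos by (simp add: q_def real_sqrt_mult real_sqrt_divide field_simps)
    moreover have "measure_pmf.expectation (binomial_graph n (p n)) (\<lambda>E. real (x_core r {..<n} E)) = x"
      unfolding x_def using p01 by (rule expectation_binomial_graph)
    ultimately show ?case using n pos by simp
  qed
  then show ?thesis using c k by (intro landau_omega.bigI[of "c / (4 * k)"]) auto
qed

end
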